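(* Let $\mathcal{R}$ be any complete representation. Every $(A\cup B)$-regular $\textsf{MRes-}\mathcal{R}$ refutation of $\textsf{CR}_n$ has size $2^{\Omega(n)}$.
   Context: The completion formulas: $\textsf{CR}_n = \exists \{x_{ij}\}_{i,j\in[n]}\ \forall z\ \exists \{a_i\}_{i\in[n]}\ \exists\{b_j\}_{j\in[n]}.\ \big(\bigwedge_{i,j\in[n]}(A_{ij}\wedge B_{ij})\big)\wedge L_A\wedge L_B$, where $A_{ij}=x_{ij}\vee z\vee a_i$, $B_{ij}=\overline{x_{ij}}\vee\bar z\vee b_j$, $L_A=\overline{a_1}\vee\dots\vee\overline{a_n}$, $L_B=\overline{b_1}\vee\dots\vee\overline{b_n}$; $A=\{a_1,\dots,a_n\}$, $B=\{b_1,\dots,b_n\}$. General setting: for a QBF $\Phi=Q.\phi$ in closed prenex CNF with existential variables $X$ and universal $U$, $y<_Q x$ means $y$ is in an earlier block, $L_Q(u)$ = existential variables left of $u$. Falsifying $u$-literal of $C\in\phi$: $0$ if $u\in C$, $1$ if $\bar u\in C$, $\ast$ otherwise; existential subclause = existential literals of $C$. A strategy for $u$ is a function from assignments of $L_Q(u)$ to $\{0,1,\ast\}$. $p\simeq q$ for $p,q\in\{0,1,\ast\}$ if $p=\ast$, $q=\ast$ or $p=q$; strategies consistent if pointwise consistent; $H\circ H'$ (for consistent $H,H'$) takes $H(\varepsilon)$ if $\ne\ast$ else $H'(\varepsilon)$; $H\overset{x}{\bowtie}H'$ is $H$ on $x=1$ and $H'$ on $x=0$. A representation is complete if every finite function has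 at least one representation in it. For a complete $\mathcal{R}$, an $\textsf{MRes-}\mathcal{R}$ derivation is a sequence of lines $(C_i,\{H^u_i:u\in U\})$, $C_i$ a clause of existential literals, $H^u_i$ strategies given in $\mathcal{R}$, each line either an axiom ($C_i$ the existential subclause of some $C\in\phi$, $H^u_i$ constant equal to the falsifying $u$-literal of $C$) or a resolution step ($a,b<i$, existential pivot $x$, $C_i=res(C_a,C_b,x)$ where $res(C\vee x,D\vee\bar x,x)=C\vee D$, and for each $u$: $H^u_i=H^u_b\overset{x}{\bowtie}H^u_a$ if $x<_Q u$; $H^u_a\simeq H^u_b$ and $H^u_i=H^u_a\circ H^u_b$ if $u<_Q x$). A refutation ends with the empty clause; its size is its number of lines. The derivation graph $G_\pi$ has the lines as nodes and edges from each hypothesis of a resolution step to its resolvent. For a set $S$ of existential variables, $\pi$ is $S$-regular if for each $x\in S$ no leaf-to-root path in $G_\pi$ uses $x$ as pivot more than once. *)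

theory Defs
  imports Complex_Main
begin

section \<open>Quantified Boolean formulas in prenex CNF\<close>

datatype 'v lit = Pos 'v | Neg 'v

fun var :: "'v lit \<Rightarrow> 'v" where
  "var (Pos v) = v"
| "var (Neg v) = v"

type_synonym 'v clause = "'v lit set"

datatype quantifier = Exists | Forall

type_synonym 'v prefix = "(quantifier \<times> 'v set) list"

datatype 'v qbf = QBF (prefix: "'v prefix") (matrix: "'v clause set")

definition ex_vars :: "'v qbf \<Rightarrow> 'v set" where
  "ex_vars \<Phi> = \<Union> {V. (Exists, V) \<in> set (prefix \<Phi>)}"

definition univ_vars :: "'v qbf \<Rightarrow> 'v set" where
  "univ_vars \<Phi> = \<Union> {V. (Forall, V) \<in> set (prefix \<Phi>)}"

definition closed_pcnf :: "'v qbf \<Rightarrow> bool" where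
  "closed_pcnf \<Phi> \<longleftrightarrow>
     (\<forall>i < length (prefix \<Phi>). finite (snd (prefix \<Phi> ! i))) \<and>
     (\<forall>i < length (prefix \<Phi>). \<forall>j < length (prefix \<Phi>).
        i \<noteq> j \<longrightarrow> snd (prefix \<Phi> ! i) \<inter> snd (prefix \<Phi> ! j) = {}) \<and>
     finite (matrix \<Phi>) \<and>
     (\<forall>C \<in> matrix \<Phi>. finite C \<and> var ` C \<subseteq> ex_vars \<Phi> \<union> univ_vars \<Phi>)"

definition before :: "'v qbf \<Rightarrow> 'v \<Rightarrow> 'v \<Rightarrow> bool" where
  "before \<Phi> y x \<longleftrightarrow>
     (\<exists>i j. i < j \<and> j < length (prefix \<Phi>) \<and>
        y \<in> snd (prefix \<Phi> ! i) \<and> x \<in> snd (prefix \<Phi> ! j))"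

definition left_vars :: "'v qbf \<Rightarrow> 'v \<Rightarrow> 'v set" where
  "left_vars \<Phi> u = {x \<in> ex_vars \<Phi>. before \<Phi> x u}"

definition ex_subclause :: "'v qbf \<Rightarrow> 'v clause \<Rightarrow> 'v clause" where
  "ex_subclause \<Phi> C = {l \<in> C. var l \<in> ex_vars \<Phi>}"


section \<open>Strategies and their representations\<close>

datatype tval = Zero | One | Star

definition falsifying_lit :: "'v \<Rightarrow> 'v clause \<Rightarrow> tval" where
  "falsifying_lit u C = (if Pos u \<in> C then Zero else if Neg u \<in> C then One else Star)"

text \<open>An assignment of a set \<open>V\<close> of variables is a partial map with domain \<open>V\<close>.  A function from
  the assignments of \<open>V\<close> to \<open>{0, 1, \<ast>}\<close> is in turn a partial map whose domain consists of
  exactly these assignments, so that equality of such functions is equality of maps.\<close>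

type_synonym 'v assignment = "'v \<rightharpoonup> bool"
type_synonym 'v strategy = "'v assignment \<rightharpoonup> tval"

definition function_on :: "'v set \<Rightarrow> 'v strategy \<Rightarrow> bool" where
  "function_on V H \<longleftrightarrow> dom H = {\<alpha>. dom \<alpha> = V}"

definition strategy_for :: "'v qbf \<Rightarrow> 'v \<Rightarrow> 'v strategy \<Rightarrow> bool" where
  "strategy_for \<Phi> u H \<longleftrightarrow> function_on (left_vars \<Phi> u) H"

definition const_function :: "'v set \<Rightarrow> tval \<Rightarrow> 'v strategy" where
  "const_function V p = (\<lambda>\<alpha>. if dom \<alpha> = V then Some p else None)"

definition consistent_val :: "tval \<Rightarrow> tval \<Rightarrow> bool" where
  "consistent_val p q \<longleftrightarrow> p = Star \<or> q = Star \<or> p = q"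

definition consistent :: "'v strategy \<Rightarrow> 'v strategy \<Rightarrow> bool" where
  "consistent H H' \<longleftrightarrow>
     (\<forall>\<alpha> p q. H \<alpha> = Some p \<longrightarrow> H' \<alpha> = Some q \<longrightarrow> consistent_val p q)"

definition compose :: "'v strategy \<Rightarrow> 'v strategy \<Rightarrow> 'v strategy" where
  "compose H H' = (\<lambda>\<alpha>. if H \<alpha> = Some Star then H' \<alpha> else H \<alpha>)"

text \<open>\<open>merge x H H'\<close> follows \<open>H\<close> where \<open>x = 1\<close> and \<open>H'\<close> where \<open>x = 0\<close>.  It is used only for
  \<open>H\<close> and \<open>H'\<close> with the same domain, on which every assignment gives \<open>x\<close> a value.\<close>

definition merge :: "'v \<Rightarrow> 'v strategy \<Rightarrow> 'v strategy \<Rightarrow> 'v strategy" where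
  "merge x H H' = (\<lambda>\<alpha>. if \<alpha> x = Some True then H \<alpha> else H' \<alpha>)"

text \<open>A representation scheme is given by a type \<open>'r\<close> of representations and the map that sends
  each of them to the function it represents.\<close>

type_synonym ('r, 'v) representation = "'r \<Rightarrow> 'v strategy"

definition complete_representation :: "('r, 'v) representation \<Rightarrow> bool" where
  "complete_representation R \<longleftrightarrow>
     (\<forall>V f. finite V \<longrightarrow> function_on V f \<longrightarrow> (\<exists>r. R r = f))"


section \<open>Merge resolution\<close>

text \<open>Every line records how it was obtained, because the derivation graph depends on it.  Line
  numbers are positions in the list of lines, starting from 0.  Only the values of \<open>strats\<close> at
  universal variables matter.\<close>

datatype 'v rule = Axiom "'v clause" | Resolve nat nat 'v

record ('r, 'v) line =
  cl :: "'v clause"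
  strats :: "'v \<Rightarrow> 'r"
  rule :: "'v rule"

definition axiom_line ::
  "('r, 'v) representation \<Rightarrow> 'v qbf \<Rightarrow> 'v clause \<Rightarrow> ('r, 'v) line \<Rightarrow> bool" where
  "axiom_line R \<Phi> C l \<longleftrightarrow>
     C \<in> matrix \<Phi> \<and> cl l = ex_subclause \<Phi> C \<and>
     (\<forall>u \<in> univ_vars \<Phi>.
        R (strats l u) = const_function (left_vars \<Phi> u) (falsifying_lit u C))"

definition is_resolvent :: "'v clause \<Rightarrow> 'v clause \<Rightarrow> 'v \<Rightarrow> 'v clause \<Rightarrow> bool" where
  "is_resolvent C D x E \<longleftrightarrow>
     Pos x \<in> C \<and> Neg x \<in> D \<and> E = (C - {Pos x}) \<union> (D - {Neg x})"

definition resolution_line ::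
  "('r, 'v) representation \<Rightarrow> 'v qbf \<Rightarrow>
   ('r, 'v) line \<Rightarrow> ('r, 'v) line \<Rightarrow> 'v \<Rightarrow> ('r, 'v) line \<Rightarrow> bool" where
  "resolution_line R \<Phi> la lb x l \<longleftrightarrow>
     x \<in> ex_vars \<Phi> \<and> is_resolvent (cl la) (cl lb) x (cl l) \<and>
     (\<forall>u \<in> univ_vars \<Phi>.
        (before \<Phi> x u \<longrightarrow>
           R (strats l u) = merge x (R (strats lb u)) (R (strats la u))) \<and>
        (before \<Phi> u x \<longrightarrow>
           consistent (R (strats la u)) (R (strats lb u)) \<and>
           R (strats l u) = compose (R (strats la u)) (R (strats lb u))))"

definition mres_derivation ::
  "('r, 'v) representation \<Rightarrow> 'v qbf \<Rightarrow> ('r, 'v) line list \<Rightarrow> bool" where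
  "mres_derivation R \<Phi> \<pi> \<longleftrightarrow>
     (\<forall>i < length \<pi>.
        var ` cl (\<pi> ! i) \<subseteq> ex_vars \<Phi> \<and>
        (\<forall>u \<in> univ_vars \<Phi>. strategy_for \<Phi> u (R (strats (\<pi> ! i) u))) \<and>
        (case rule (\<pi> ! i) of
           Axiom C \<Rightarrow> axiom_line R \<Phi> C (\<pi> ! i)
         | Resolve a b x \<Rightarrow>
             a < i \<and> b < i \<and> resolution_line R \<Phi> (\<pi> ! a) (\<pi> ! b) x (\<pi> ! i)))"

definition mres_refutation ::
  "('r, 'v) representation \<Rightarrow> 'v qbf \<Rightarrow> ('r, 'v) line list \<Rightarrow> bool" where
  "mres_refutation R \<Phi> \<pi> \<longleftrightarrow>
     mres_derivation R \<Phi> \<pi> \<and> \<pi> \<noteq> [] \<and> cl (last \<pi>) = {}"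

definition proof_size :: "('r, 'v) line list \<Rightarrow> nat" where
  "proof_size \<pi> = length \<pi>"

definition derivation_edge :: "('r, 'v) line list \<Rightarrow> nat \<Rightarrow> nat \<Rightarrow> bool" where
  "derivation_edge \<pi> i j \<longleftrightarrow>
     i < length \<pi> \<and> j < length \<pi> \<and>
     (\<exists>a b x. rule (\<pi> ! j) = Resolve a b x \<and> (i = a \<or> i = b))"

text \<open>The leaves of the derivation graph are the axiom lines; its root is the last line.\<close>

definition leaf_to_root_path :: "('r, 'v) line list \<Rightarrow> nat list \<Rightarrow> bool" where
  "leaf_to_root_path \<pi> p \<longleftrightarrow>
     \<pi> \<noteq> [] \<and> p \<noteq> [] \<and> hd p < length \<pi> \<and>
     (\<exists>C. rule (\<pi> ! hd p) = Axiom C) \<and>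
     last p = length \<pi> - 1 \<and>
     (\<forall>k. Suc k < length p \<longrightarrow> derivation_edge \<pi> (p ! k) (p ! Suc k))"

definition has_pivot :: "('r, 'v) line \<Rightarrow> 'v \<Rightarrow> bool" where
  "has_pivot l x \<longleftrightarrow> (\<exists>a b. rule l = Resolve a b x)"

definition regular_wrt :: "'v set \<Rightarrow> ('r, 'v) line list \<Rightarrow> bool" where
  "regular_wrt S \<pi> \<longleftrightarrow>
     (\<forall>x \<in> S. \<forall>p. leaf_to_root_path \<pi> p \<longrightarrow>
        card {k. k < length p \<and> has_pivot (\<pi> ! (p ! k)) x} \<le> 1)"


section \<open>The completion formulas\<close>

datatype cr_var = Xvar nat nat | Zvar | Avar nat | Bvar nat

definition A_vars :: "nat \<Rightarrow> cr_var set" where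
  "A_vars n = Avar ` {1..n}"

definition B_vars :: "nat \<Rightarrow> cr_var set" where
  "B_vars n = Bvar ` {1..n}"

definition A_clause :: "nat \<Rightarrow> nat \<Rightarrow> cr_var clause" where
  "A_clause i j = {Pos (Xvar i j), Pos Zvar, Pos (Avar i)}"

definition B_clause :: "nat \<Rightarrow> nat \<Rightarrow> cr_var clause" where
  "B_clause i j = {Neg (Xvar i j), Neg Zvar, Pos (Bvar j)}"

definition LA_clause :: "nat \<Rightarrow> cr_var clause" where
  "LA_clause n = {Neg (Avar i) | i. i \<in> {1..n}}"

definition LB_clause :: "nat \<Rightarrow> cr_var clause" where
  "LB_clause n = {Neg (Bvar j) | j. j \<in> {1..n}}"

definition CR :: "nat \<Rightarrow> cr_var qbf" where
  "CR n = QBF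
     [(Exists, {Xvar i j | i j. i \<in> {1..n} \<and> j \<in> {1..n}}),
      (Forall, {Zvar}),
      (Exists, A_vars n \<union> B_vars n)]
     ({A_clause i j | i j. i \<in> {1..n} \<and> j \<in> {1..n}} \<union>
      {B_clause i j | i j. i \<in> {1..n} \<and> j \<in> {1..n}} \<union>
      {LA_clause n, LB_clause n})"

lemma finite_pair_image: "finite {f i j | i j. i \<in> {1..n::nat} \<and> j \<in> {1..n::nat}}"
proof -
  have "{f i j | i j. i \<in> {1..n} \<and> j \<in> {1..n}} \<subseteq> (\<lambda>(i, j). f i j) ` ({1..n} \<times> {1..n})"
    by force
  then show ?thesis by (rule finite_subset) simp
qed

lemma closed_pcnf_CR: "closed_pcnf (CR n)"
proof -
  have vars: "ex_vars (CR n) \<union> univ_vars (CR n) =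
      {Xvar i j | i j. i \<in> {1..n} \<and> j \<in> {1..n}} \<union> {Zvar} \<union> (A_vars n \<union> B_vars n)"
    by (auto simp: ex_vars_def univ_vars_def CR_def)
  have "\<forall>C \<in> matrix (CR n). finite C \<and> var ` C \<subseteq> ex_vars (CR n) \<union> univ_vars (CR n)"
    unfolding vars
    by (auto simp: CR_def A_clause_def B_clause_def LA_clause_def LB_clause_def
        A_vars_def B_vars_def)
  moreover have "finite (matrix (CR n))"
    using finite_pair_image[of A_clause n] finite_pair_image[of B_clause n] by (simp add: CR_def)
  moreover have "\<forall>i < length (prefix (CR n)). finite (snd (prefix (CR n) ! i))"
    using finite_pair_image[of Xvar n] by (simp add: CR_def A_vars_def B_vars_def less_Suc_eq)
  moreover have "\<forall>i < length (prefix (CR n)). \<forall>j < length (prefix (CR n)).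
      i \<noteq> j \<longrightarrow> snd (prefix (CR n) ! i) \<inter> snd (prefix (CR n) ! j) = {}"
    by (auto simp: CR_def A_vars_def B_vars_def less_Suc_eq)
  ultimately show ?thesis unfolding closed_pcnf_def by blast
qed

end

theory Submission
  imports Defs
begin

text \<open>Fix an assignment \<open>\<alpha>\<close> of the \<open>x\<close>-variables.  Walking down from the empty clause along
  \<open>x\<close>-pivots, always to the premise falsified by \<open>\<alpha>\<close>, one reaches a clause without \<open>A \<union> B\<close>-variables
  that is falsified by \<open>\<alpha>\<close> and was obtained with a pivot in \<open>A \<union> B\<close>, say \<open>a\<^sub>i\<close>.  By regularity, the
  premise containing \<open>a\<^sub>i\<close> does not depend on \<open>L\<^sub>A\<close>, so all axioms \<open>A\<^sub>k\<^sub>j\<close> it uses have \<open>k = i\<close>, whereas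
  the premise containing the negation of \<open>a\<^sub>i\<close> uses none of them.  As a pivot \<open>x\<^sub>k\<^sub>j\<close> needs \<open>A\<^sub>k\<^sub>j\<close>, the
  strategies of the two premises depend on disjoint sets of variables.  Only \<open>L\<^sub>A\<close> and \<open>L\<^sub>B\<close> carry the
  value \<open>\<ast>\<close>, so consistency makes both strategies equal and hence constant.  By soundness, a clause over
  the \<open>x\<close>-variables with the constant strategy 0 (1) contains a positive (negative) literal from every row
  (column), so it is falsified by at most a fraction \<open>2\<^sup>-\<^sup>n\<close> of the assignments.\<close>

section \<open>Derivation graphs\<close>

abbreviation ancestor :: "('r, 'v) line list \<Rightarrow> nat \<Rightarrow> nat \<Rightarrow> bool" where
  "ancestor \<pi> \<equiv> (derivation_edge \<pi>)\<^sup>*\<^sup>*"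

text \<open>All pivots of the subderivation of line \<open>m\<close>. The closure is reflexive, so
  the pivot of \<open>m\<close> itself counts.\<close>

definition pivots :: "('r, 'v) line list \<Rightarrow> nat \<Rightarrow> 'v set" where
  "pivots \<pi> m = {x. \<exists>i. ancestor \<pi> i m \<and> has_pivot (\<pi> ! i) x}"

lemma pivots_mono: "ancestor \<pi> i m \<Longrightarrow> pivots \<pi> i \<subseteq> pivots \<pi> m"
  unfolding pivots_def by (auto intro: rtranclp_trans)

lemma pivot_in_pivots: "rule (\<pi> ! m) = Resolve a b x \<Longrightarrow> x \<in> pivots \<pi> m"
  unfolding pivots_def has_pivot_def by blast

lemma derivation_Axiom:
  assumes "mres_derivation R \<Phi> \<pi>" "m < length \<pi>" "rule (\<pi> ! m) = Axiom C"
  shows "axiom_line R \<Phi> C (\<pi> ! m)"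
  using assms unfolding mres_derivation_def by fastforce

lemma derivation_Resolve:
  assumes "mres_derivation R \<Phi> \<pi>" "m < length \<pi>" "rule (\<pi> ! m) = Resolve a b x"
  shows "a < m" "b < m" "resolution_line R \<Phi> (\<pi> ! a) (\<pi> ! b) x (\<pi> ! m)"
    "derivation_edge \<pi> a m" "derivation_edge \<pi> b m"
proof -
  show *: "a < m" "b < m" "resolution_line R \<Phi> (\<pi> ! a) (\<pi> ! b) x (\<pi> ! m)"
    using assms unfolding mres_derivation_def by fastforce+
  then show "derivation_edge \<pi> a m" "derivation_edge \<pi> b m"
    using assms unfolding derivation_edge_def by auto
qed

lemma derivation_induct [consumes 2, case_names Axiom Resolve]:
  assumes der: "mres_derivation R \<Phi> \<pi>" and "m < length \<pi>"
    and ax: "\<And>m C. m < length \<pi> \<Longrightarrow> rule (\<pi> ! m) = Axiom C \<Longrightarrow> axiom_line R \<Phi> C (\<pi> ! m) \<Longrightarrow> P m"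
    and res: "\<And>m a b x. m < length \<pi> \<Longrightarrow> rule (\<pi> ! m) = Resolve a b x \<Longrightarrow>
      a < length \<pi> \<Longrightarrow> b < length \<pi> \<Longrightarrow> derivation_edge \<pi> a m \<Longrightarrow> derivation_edge \<pi> b m \<Longrightarrow>
      resolution_line R \<Phi> (\<pi> ! a) (\<pi> ! b) x (\<pi> ! m) \<Longrightarrow> P a \<Longrightarrow> P b \<Longrightarrow> P m"
  shows "P m"
  using \<open>m < length \<pi>\<close>
proof (induction m rule: less_induct)
  case (less m)
  show ?case
  proof (cases "rule (\<pi> ! m)")
    case (Axiom C)
    then show ?thesis using ax derivation_Axiom[OF der] less.prems by blast
  next
    case (Resolve a b x)
    note d = derivation_Resolve[OF der less.prems Resolve]
    show ?thesis
      using d less by (intro res[OF less.prems Resolve]) auto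
  qed
qed

section \<open>Tracing literals and pivots back to axioms\<close>

lemma ancestor_less_length: "ancestor \<pi> i m \<Longrightarrow> m < length \<pi> \<Longrightarrow> i < length \<pi>"
  by (induction rule: converse_rtranclp_induct) (auto simp: derivation_edge_def)

lemma leaf_ancestor:
  assumes "mres_derivation R \<Phi> \<pi>" "m < length \<pi>"
  shows "\<exists>i C. ancestor \<pi> i m \<and> rule (\<pi> ! i) = Axiom C"
  using assms
  by (induction rule: derivation_induct) (blast intro: rtranclp.rtrancl_into_rtrancl)+

text \<open>A resolution step removes only literals of its own pivot variable. Regularity later
  supplies the hypothesis on pivots, so that a literal of an axiom must still be present in the
  clause under study.\<close>

lemma literal_persists:
  assumes "mres_derivation R \<Phi> \<pi>" "ancestor \<pi> i m" "l \<in> cl (\<pi> ! i)" "var l \<notin> pivots \<pi> m"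
  shows "l \<in> cl (\<pi> ! m)"
  using assms(2,4)
proof (induction rule: rtranclp_induct)
  case base
  then show ?case using assms by simp
next
  case (step j m)
  then obtain a b x where r: "rule (\<pi> ! m) = Resolve a b x" "j = a \<or> j = b" "m < length \<pi>"
    unfolding derivation_edge_def by blast
  have "l \<in> cl (\<pi> ! j)"
    using step pivots_mono[of \<pi> j m] by blast
  moreover have "var l \<noteq> x"
    using pivot_in_pivots[OF r(1)] step.prems by blast
  moreover have "is_resolvent (cl (\<pi> ! a)) (cl (\<pi> ! b)) x (cl (\<pi> ! m))"
    using derivation_Resolve(3)[OF assms(1) r(3,1)] unfolding resolution_line_def by blast
  ultimately show ?case
    using r(2) unfolding is_resolvent_def by (metis DiffI UnCI singletonD var.simps)
qed

lemma literal_origin: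
  assumes "mres_derivation R \<Phi> \<pi>" "m < length \<pi>" "l \<in> cl (\<pi> ! m)"
  shows "\<exists>i C. ancestor \<pi> i m \<and> rule (\<pi> ! i) = Axiom C \<and> l \<in> cl (\<pi> ! i)"
  using assms
proof (induction rule: derivation_induct)
  case (Axiom m C)
  then show ?case by blast
next
  case (Resolve m a b x)
  then have "l \<in> cl (\<pi> ! a) \<or> l \<in> cl (\<pi> ! b)"
    unfolding resolution_line_def is_resolvent_def by blast
  with Resolve show ?case by (blast intro: rtranclp.rtrancl_into_rtrancl)
qed

text \<open>Both polarities of a pivot occur in the premises of its step, and resolution creates no
  literals, so the literal of either sign can be traced to an axiom.\<close>

lemma pivot_origin:
  assumes "mres_derivation R \<Phi> \<pi>" "m < length \<pi>" "var l \<in> pivots \<pi> m"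
  shows "\<exists>i C. ancestor \<pi> i m \<and> rule (\<pi> ! i) = Axiom C \<and> l \<in> cl (\<pi> ! i)"
proof -
  obtain k a b where k: "ancestor \<pi> k m" "rule (\<pi> ! k) = Resolve a b (var l)"
    using assms(3) unfolding pivots_def has_pivot_def by blast
  have "k < length \<pi>" using ancestor_less_length k(1) assms(2) by blast
  note d = derivation_Resolve[OF assms(1) this k(2)]
  have len: "a < length \<pi>" "b < length \<pi>" using d \<open>k < length \<pi>\<close> by auto
  have "l \<in> cl (\<pi> ! a) \<or> l \<in> cl (\<pi> ! b)"
    using d(3) unfolding resolution_line_def is_resolvent_def by (cases l) auto
  then show ?thesis
    using literal_origin[OF assms(1) len(1), of l] literal_origin[OF assms(1) len(2), of l] d(4,5) k(1)
    by (meson rtranclp.rtrancl_into_rtrancl rtranclp_trans)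
qed

section \<open>Paths and regularity\<close>

lemma rtranclp_successively_last:
  assumes "R\<^sup>*\<^sup>* i j"
  shows "\<exists>p. successively R (i # p) \<and> last (i # p) = j"
  using assms
proof (induction rule: converse_rtranclp_induct)
  case base
  then show ?case by (intro exI[of _ "[]"]) simp
next
  case (step i k)
  then obtain p where "successively R (k # p)" "last (k # p) = j" by blast
  with step show ?case by (intro exI[of _ "k # p"]) simp
qed

text \<open>This form exposes the last node of a path, the previous one the first node; segments can
  thus be joined without repeating the node where they meet.\<close>

lemma rtranclp_successively_hd:
  assumes "R\<^sup>*\<^sup>* i j"
  shows "\<exists>p. successively R (p @ [j]) \<and> hd (p @ [j]) = i"
  using assms
proof (induction rule: rtranclp_induct)
  case base
  then show ?case by (intro exI[of _ "[]"]) simp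
next
  case (step j k)
  then obtain p where "successively R (p @ [j])" "hd (p @ [j]) = i" by blast
  with step show ?case
    by (intro exI[of _ "p @ [j]"]) (auto simp: successively_append_iff hd_append)
qed

text \<open>An earlier step on \<open>x\<close> above the premise \<open>a\<close> would share a
  path with \<open>m\<close>. As regularity speaks of complete leaf-to-root paths, this path is
  prolonged back to an axiom and forward to the last line, which \<open>m\<close> must therefore
  reach.\<close>

lemma regular_pivot_unique:
  assumes der: "mres_derivation R \<Phi> \<pi>" and reg: "regular_wrt S \<pi>" and "x \<in> S" and "\<pi> \<noteq> []"
    and m: "ancestor \<pi> m (length \<pi> - 1)" "has_pivot (\<pi> ! m) x" and e: "derivation_edge \<pi> a m"
  shows "x \<notin> pivots \<pi> a"
proof
  assume "x \<in> pivots \<pi> a"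
  then obtain k where k: "ancestor \<pi> k a" "has_pivot (\<pi> ! k) x"
    unfolding pivots_def by blast
  have "a < length \<pi>" using e unfolding derivation_edge_def by blast
  then have "k < length \<pi>" using k ancestor_less_length by blast
  then obtain i C where i: "ancestor \<pi> i k" "rule (\<pi> ! i) = Axiom C"
    using leaf_ancestor[OF der] by blast
  have "i < length \<pi>" using i \<open>k < length \<pi>\<close> ancestor_less_length by blast
  let ?E = "derivation_edge \<pi>"
  obtain p where p: "successively ?E (p @ [k])" "hd (p @ [k]) = i"
    using rtranclp_successively_hd[OF i(1)] by blast
  obtain q where q: "successively ?E (k # q)" "last (k # q) = a"
    using rtranclp_successively_last[OF k(1)] by blast
  obtain r where r: "successively ?E (m # r)" "last (m # r) = length \<pi> - 1"
    using rtranclp_successively_last[OF m(1)] by blast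
  \<comment> \<open>\<open>p\<close> stops short of \<open>k\<close>, so \<open>w\<close> runs from
    the leaf \<open>i\<close> through \<open>k\<close> to \<open>a\<close>, then through
    \<open>m\<close> to the root.\<close>
  define w where "w = p @ (k # q) @ (m # r)"
  have "successively ?E w"
  proof -
    have "successively ?E ((k # q) @ (m # r))"
      using q r(1) e by (simp only: successively_append_iff list.sel simp_thms)
    then show ?thesis
      using p(1) unfolding w_def by (auto simp: successively_append_iff)
  qed
  then have "\<forall>t. Suc t < length w \<longrightarrow> ?E (w ! t) (w ! Suc t)"
    unfolding successively_conv_nth by blast
  moreover have "hd w = i" using p(2) unfolding w_def by (simp add: hd_append split: if_splits)
  moreover have "last w = length \<pi> - 1" using r(2) unfolding w_def by simp
  ultimately have "leaf_to_root_path \<pi> w"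
    using i \<open>i < length \<pi>\<close> \<open>\<pi> \<noteq> []\<close> unfolding leaf_to_root_path_def by (auto simp: w_def)
  then have "card {t. t < length w \<and> has_pivot (\<pi> ! (w ! t)) x} \<le> 1"
    using reg \<open>x \<in> S\<close> unfolding regular_wrt_def by blast
  \<comment> \<open>These are the positions of \<open>k\<close> and \<open>m\<close> in
    \<open>w\<close>; they are distinct.\<close>
  moreover have "{length p, length p + Suc (length q)} \<subseteq> {t. t < length w \<and> has_pivot (\<pi> ! (w ! t)) x}"
    using k m by (auto simp: w_def nth_append)
  then have "card {length p, length p + Suc (length q)} \<le>
      card {t. t < length w \<and> has_pivot (\<pi> ! (w ! t)) x}"
    by (intro card_mono) auto
  ultimately show False by simp
qed

section \<open>Lines of derivations from the completion formulas\<close>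

definition X_vars :: "nat \<Rightarrow> cr_var set" where
  "X_vars n = {Xvar i j | i j. i \<in> {1..n} \<and> j \<in> {1..n}}"

abbreviation strategy_of ::
  "('r, cr_var) representation \<Rightarrow> ('r, cr_var) line list \<Rightarrow> nat \<Rightarrow> cr_var strategy" where
  "strategy_of R \<pi> m \<equiv> R (strats (\<pi> ! m) Zvar)"

lemma ex_vars_CR: "ex_vars (CR n) = X_vars n \<union> A_vars n \<union> B_vars n"
  by (auto simp: ex_vars_def CR_def X_vars_def)

lemma univ_vars_CR: "univ_vars (CR n) = {Zvar}"
  by (auto simp: univ_vars_def CR_def)

lemma before_Zvar: "before (CR n) x Zvar \<longleftrightarrow> x \<in> X_vars n"
proof
  assume "before (CR n) x Zvar"
  then show "x \<in> X_vars n"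
    by (auto simp: before_def CR_def less_Suc_eq X_vars_def A_vars_def B_vars_def)
next
  assume "x \<in> X_vars n"
  then show "before (CR n) x Zvar"
    unfolding before_def by (intro exI[of _ 0] exI[of _ 1]) (auto simp: CR_def X_vars_def)
qed

lemma Zvar_before: "before (CR n) Zvar x \<longleftrightarrow> x \<in> A_vars n \<union> B_vars n"
proof
  assume "before (CR n) Zvar x"
  then show "x \<in> A_vars n \<union> B_vars n"
    by (auto simp: before_def CR_def less_Suc_eq X_vars_def A_vars_def B_vars_def)
next
  assume "x \<in> A_vars n \<union> B_vars n"
  then show "before (CR n) Zvar x"
    unfolding before_def by (intro exI[of _ 1] exI[of _ 2]) (auto simp: CR_def)
qed

lemma left_vars_Zvar: "left_vars (CR n) Zvar = X_vars n"
  by (auto simp: left_vars_def before_Zvar ex_vars_CR)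

lemma axiom_line_CR:
  assumes "axiom_line R (CR n) C l"
  shows "R (strats l Zvar) = const_function (X_vars n) (falsifying_lit Zvar C)"
    "C \<in> matrix (CR n)" "cl l = {l \<in> C. var l \<noteq> Zvar}"
proof -
  show "R (strats l Zvar) = const_function (X_vars n) (falsifying_lit Zvar C)"
    using assms unfolding axiom_line_def univ_vars_CR by (simp add: left_vars_Zvar)
  show C: "C \<in> matrix (CR n)" using assms unfolding axiom_line_def by blast
  then have "var ` C \<subseteq> ex_vars (CR n) \<union> univ_vars (CR n)"
    using closed_pcnf_CR unfolding closed_pcnf_def by blast
  moreover have "Zvar \<notin> ex_vars (CR n)"
    by (auto simp: ex_vars_CR X_vars_def A_vars_def B_vars_def)
  ultimately show "cl l = {l \<in> C. var l \<noteq> Zvar}"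
    using assms unfolding axiom_line_def ex_subclause_def univ_vars_CR by auto
qed

lemma axiom_clause_CR_cases:
  assumes "axiom_line R (CR n) C l"
  obtains i j where "i \<in> {1..n}" "j \<in> {1..n}" "cl l = {Pos (Xvar i j), Pos (Avar i)}"
      "R (strats l Zvar) = const_function (X_vars n) Zero"
    | i j where "i \<in> {1..n}" "j \<in> {1..n}" "cl l = {Neg (Xvar i j), Pos (Bvar j)}"
      "R (strats l Zvar) = const_function (X_vars n) One"
    | "cl l = LA_clause n" | "cl l = LB_clause n"
proof -
  note a = axiom_line_CR[OF assms]
  consider i j where "i \<in> {1..n}" "j \<in> {1..n}" "C = A_clause i j"
    | i j where "i \<in> {1..n}" "j \<in> {1..n}" "C = B_clause i j"
    | "C = LA_clause n" | "C = LB_clause n"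
    using a(2) unfolding CR_def qbf.sel by blast
  then show thesis
  proof cases
    case (1 i j)
    have "cl l = {Pos (Xvar i j), Pos (Avar i)}" unfolding a(3) 1(3) A_clause_def by auto
    moreover have "falsifying_lit Zvar C = Zero" unfolding 1(3) A_clause_def falsifying_lit_def by simp
    ultimately show thesis using that(1) 1(1,2) a(1) by simp
  next
    case (2 i j)
    have "cl l = {Neg (Xvar i j), Pos (Bvar j)}" unfolding a(3) 2(3) B_clause_def by auto
    moreover have "falsifying_lit Zvar C = One" unfolding 2(3) B_clause_def falsifying_lit_def by simp
    ultimately show thesis using that(2) 2(1,2) a(1) by simp
  next
    case 3
    have "cl l = LA_clause n" unfolding a(3) 3 LA_clause_def by auto
    then show thesis by (rule that(3))
  next
    case 4
    have "cl l = LB_clause n" unfolding a(3) 4 LB_clause_def by auto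
    then show thesis by (rule that(4))
  qed
qed

lemma resolution_line_CR_cases:
  assumes "resolution_line R (CR n) la lb x l"
  obtains "x \<in> X_vars n" "is_resolvent (cl la) (cl lb) x (cl l)"
      "R (strats l Zvar) = merge x (R (strats lb Zvar)) (R (strats la Zvar))"
    | "x \<in> A_vars n \<union> B_vars n" "is_resolvent (cl la) (cl lb) x (cl l)"
      "consistent (R (strats la Zvar)) (R (strats lb Zvar))"
      "R (strats l Zvar) = compose (R (strats la Zvar)) (R (strats lb Zvar))"
proof -
  have "x \<in> X_vars n \<or> x \<in> A_vars n \<union> B_vars n"
    using assms unfolding resolution_line_def ex_vars_CR by blast
  then show thesis
  proof
    assume "x \<in> X_vars n"
    then show thesis
      using assms that(1) unfolding resolution_line_def univ_vars_CR before_Zvar[symmetric] by blast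
  next
    assume "x \<in> A_vars n \<union> B_vars n"
    then show thesis
      using assms that(2) unfolding resolution_line_def univ_vars_CR Zvar_before[symmetric] by blast
  qed
qed

section \<open>Domains, dependence and values of the strategies\<close>

lemma dom_strategy_of:
  assumes "mres_derivation R (CR n) \<pi>" "m < length \<pi>"
  shows "dom (strategy_of R \<pi> m) = {\<alpha>. dom \<alpha> = X_vars n}"
  using assms unfolding mres_derivation_def univ_vars_CR strategy_for_def function_on_def
  by (simp add: left_vars_Zvar)

lemma strategy_of_total:
  assumes "mres_derivation R (CR n) \<pi>" "m < length \<pi>" "dom \<alpha> = X_vars n"
  obtains p where "strategy_of R \<pi> m \<alpha> = Some p"
proof -
  have "\<alpha> \<in> dom (strategy_of R \<pi> m)"
    unfolding dom_strategy_of[OF assms(1,2)] using assms(3) by simp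
  then show thesis using that by blast
qed

text \<open>Axioms have constant strategies, and only \<open>merge\<close> queries a variable,
  namely the pivot; \<open>compose\<close> acts pointwise.\<close>

lemma strategy_depends_on_pivots:
  assumes "mres_derivation R (CR n) \<pi>" "m < length \<pi>"
    and "dom \<alpha> = X_vars n" "dom \<beta> = X_vars n" "\<forall>x \<in> pivots \<pi> m. \<alpha> x = \<beta> x"
  shows "strategy_of R \<pi> m \<alpha> = strategy_of R \<pi> m \<beta>"
  using assms
proof (induction rule: derivation_induct)
  case (Axiom m C)
  then show ?case using axiom_line_CR(1)[of R n C] by (simp add: const_function_def)
next
  case (Resolve m a b x)
  have "pivots \<pi> a \<subseteq> pivots \<pi> m" "pivots \<pi> b \<subseteq> pivots \<pi> m" "x \<in> pivots \<pi> m"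
    by (rule pivots_mono, rule r_into_rtranclp, fact Resolve.hyps)+ (rule pivot_in_pivots[OF Resolve.hyps(2)])
  then have eqs: "strategy_of R \<pi> a \<alpha> = strategy_of R \<pi> a \<beta>"
    "strategy_of R \<pi> b \<alpha> = strategy_of R \<pi> b \<beta>" "\<alpha> x = \<beta> x"
    using Resolve.IH Resolve.prems by blast+
  show ?case
    using Resolve.hyps(7) by (cases rule: resolution_line_CR_cases) (auto simp: merge_def compose_def eqs)
qed

text \<open>The long clauses consist of negative literals over A \<union> B, so they are never a
  premise for an x-pivot nor the positive premise for any pivot. A \<open>Star\<close> in a
  resolvent would have to come from such a premise.\<close>

lemma Star_only_long_clauses:
  assumes "mres_derivation R (CR n) \<pi>" "m < length \<pi>" "strategy_of R \<pi> m \<alpha> = Some Star"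
  shows "cl (\<pi> ! m) = LA_clause n \<or> cl (\<pi> ! m) = LB_clause n"
  using assms
proof (induction rule: derivation_induct)
  case (Axiom m C)
  from Axiom.hyps(3) show ?case
    by (cases rule: axiom_clause_CR_cases)
      (use Axiom.prems in \<open>auto simp: const_function_def split: if_splits\<close>)
next
  case (Resolve m a b x)
  have no_pos: "Pos x \<notin> LA_clause n" "Pos x \<notin> LB_clause n"
    by (auto simp: LA_clause_def LB_clause_def)
  have no_X: "Neg x \<notin> LA_clause n" "Neg x \<notin> LB_clause n" if "x \<in> X_vars n"
    using that by (auto simp: LA_clause_def LB_clause_def X_vars_def)
  from Resolve.hyps(7) show ?case
  proof (cases rule: resolution_line_CR_cases)
    case 1
    then have "strategy_of R \<pi> a \<alpha> = Some Star \<or> strategy_of R \<pi> b \<alpha> = Some Star"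
      using Resolve.prems by (simp add: merge_def split: if_splits)
    then show ?thesis
      using Resolve.IH 1(2) no_pos no_X[OF 1(1)] unfolding is_resolvent_def by metis
  next
    case 2
    \<comment> \<open>\<open>compose\<close> yields \<open>Star\<close> only where its first
      argument does, and the first premise contains \<open>Pos x\<close>.\<close>
    then have "strategy_of R \<pi> a \<alpha> = Some Star"
      using Resolve.prems by (simp add: compose_def split: if_splits)
    then show ?thesis
      using Resolve.IH(1) 2(2) no_pos unfolding is_resolvent_def by metis
  qed
qed

section \<open>Soundness\<close>

fun satisfies :: "('v \<Rightarrow> bool) \<Rightarrow> 'v lit \<Rightarrow> bool" where
  "satisfies s (Pos v) \<longleftrightarrow> s v"
| "satisfies s (Neg v) \<longleftrightarrow> \<not> s v"

definition falsifies :: "('v \<Rightarrow> bool) \<Rightarrow> 'v clause \<Rightarrow> bool" where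
  "falsifies s C \<longleftrightarrow> (\<forall>l \<in> C. \<not> satisfies s l)"

definition restrict_assignment :: "('v \<Rightarrow> bool) \<Rightarrow> 'v set \<Rightarrow> 'v assignment" where
  "restrict_assignment s V = (\<lambda>x. if x \<in> V then Some (s x) else None)"

lemma dom_restrict_assignment [simp]: "dom (restrict_assignment s V) = V"
  by (auto simp: restrict_assignment_def dom_def)

text \<open>Compliance of the universal player's move \<open>b\<close> with a strategy value;
  \<open>Star\<close> leaves the move free.\<close>

definition follows :: "bool \<Rightarrow> tval \<Rightarrow> bool" where
  "follows b p \<longleftrightarrow> p = Star \<or> p = (if b then One else Zero)"

text \<open>If \<open>z\<close> is played according to the strategy of a line, the clause of the
  line is implied by the matrix. At an axiom the \<open>z\<close>-literal is falsified, so an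
  existential literal must hold; \<open>merge\<close> selects the premise whose pivot literal is
  false; consistency makes the move comply with both premises of \<open>compose\<close>.\<close>

lemma line_sound:
  assumes "mres_derivation R (CR n) \<pi>" "m < length \<pi>"
    and sat: "\<forall>C \<in> matrix (CR n). \<not> falsifies s C"
    and "strategy_of R \<pi> m (restrict_assignment s (X_vars n)) = Some p" "follows (s Zvar) p"
  shows "\<not> falsifies s (cl (\<pi> ! m))"
  using assms(1,2,4,5)
proof (induction arbitrary: p rule: derivation_induct)
  case (Axiom m C)
  note a = axiom_line_CR[OF Axiom.hyps(3)]
  have "p = falsifying_lit Zvar C"
    using a(1) Axiom.prems by (simp add: const_function_def)
  \<comment> \<open>\<open>falsifying_lit\<close> tests \<open>Pos\<close> first, so it would leave
    a literal true in a clause with both literals of \<open>z\<close>.\<close>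
  moreover have "Pos Zvar \<notin> C \<or> Neg Zvar \<notin> C"
    using a(2) by (auto simp: CR_def A_clause_def B_clause_def LA_clause_def LB_clause_def)
  ultimately have "\<not> satisfies s l" if "l \<in> C" "var l = Zvar" for l
    using Axiom.prems that by (cases l) (auto simp: falsifying_lit_def follows_def split: if_splits)
  then show ?case
    using sat a(2,3) unfolding falsifies_def by blast
next
  case (Resolve m a b x)
  let ?\<alpha> = "restrict_assignment s (X_vars n)"
  obtain qa where qa: "strategy_of R \<pi> a ?\<alpha> = Some qa"
    by (rule strategy_of_total[OF assms(1) Resolve.hyps(3)]) (rule dom_restrict_assignment)
  obtain qb where qb: "strategy_of R \<pi> b ?\<alpha> = Some qb"
    by (rule strategy_of_total[OF assms(1) Resolve.hyps(4)]) (rule dom_restrict_assignment)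
  note q = qa qb
  from Resolve.hyps(7) show ?case
  proof (cases rule: resolution_line_CR_cases)
    case 1
    then have "?\<alpha> x = Some (s x)" by (simp add: restrict_assignment_def)
    \<comment> \<open>The premise chosen by \<open>s x\<close> contains the pivot literal that
      \<open>s\<close> falsifies, so its true literal survives in the resolvent.\<close>
    then have "p = (if s x then qb else qa)"
      using 1 q Resolve.prems by (auto simp: merge_def)
    then have "\<not> falsifies s (cl (\<pi> ! (if s x then b else a)))"
      using Resolve.IH q Resolve.prems by auto
    then show ?thesis
      using 1 unfolding is_resolvent_def falsifies_def by (auto split: if_splits)
  next
    case 2
    then have "p = (if qa = Star then qb else qa)" "consistent_val qa qb"
      using q Resolve.prems unfolding consistent_def by (auto simp: compose_def)
    then have "follows (s Zvar) qa" "follows (s Zvar) qb"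
      using Resolve.prems by (auto simp: follows_def consistent_val_def split: if_splits)
    then have "\<not> falsifies s (cl (\<pi> ! a))" "\<not> falsifies s (cl (\<pi> ! b))"
      using Resolve.IH q by blast+
    then show ?thesis
      using 2(2) unfolding is_resolvent_def falsifies_def
      by (cases "s x") (metis DiffI UnCI satisfies.simps singletonD)+
  qed
qed

lemma matrix_CR_satisfied:
  assumes "\<And>i j. i \<in> {1..n} \<Longrightarrow> j \<in> {1..n} \<Longrightarrow> s (Xvar i j) \<or> s Zvar \<or> s (Avar i)"
    and "\<And>i j. i \<in> {1..n} \<Longrightarrow> j \<in> {1..n} \<Longrightarrow> \<not> s (Xvar i j) \<or> \<not> s Zvar \<or> s (Bvar j)"
    and "i \<in> {1..n}" "\<not> s (Avar i)" "j \<in> {1..n}" "\<not> s (Bvar j)"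
  shows "\<forall>C \<in> matrix (CR n). \<not> falsifies s C"
proof -
  have "\<not> falsifies s (A_clause i j)" if "i \<in> {1..n}" "j \<in> {1..n}" for i j
    using assms(1)[OF that] by (auto simp: falsifies_def A_clause_def)
  moreover have "\<not> falsifies s (B_clause i j)" if "i \<in> {1..n}" "j \<in> {1..n}" for i j
    using assms(2)[OF that] by (auto simp: falsifies_def B_clause_def)
  moreover have "Neg (Avar i) \<in> LA_clause n" "Neg (Bvar j) \<in> LB_clause n"
    using assms by (auto simp: LA_clause_def LB_clause_def)
  then have "\<not> falsifies s (LA_clause n)" "\<not> falsifies s (LB_clause n)"
    using assms(4,6) unfolding falsifies_def by force+
  ultimately show ?thesis unfolding CR_def by auto
qed

section \<open>Width of clauses with a constant strategy\<close>

text \<open>Otherwise the clause can be falsified with all of row \<open>i\<close> true; then z = 0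
  and only \<open>Avar i\<close> false among the a-variables satisfy the matrix, against
  soundness.\<close>

lemma wide_clause_Zero:
  assumes der: "mres_derivation R (CR n) \<pi>" and m: "m < length \<pi>"
    and H: "strategy_of R \<pi> m = const_function (X_vars n) Zero"
    and X: "var ` cl (\<pi> ! m) \<subseteq> X_vars n"
    and taut: "\<And>x. Pos x \<in> cl (\<pi> ! m) \<Longrightarrow> Neg x \<notin> cl (\<pi> ! m)"
    and i: "i \<in> {1..n}"
  shows "\<exists>j \<in> {1..n}. Pos (Xvar i j) \<in> cl (\<pi> ! m)"
proof (rule ccontr)
  assume neg: "\<not> ?thesis"
  \<comment> \<open>All b-variables are false, so any index, here \<open>i\<close>, witnesses the
    clause L_B. Positive literals of the clause are false by definition, negative ones by
    \<open>taut\<close>.\<close>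
  define s where "s v = (case v of Xvar k j \<Rightarrow> Pos v \<notin> cl (\<pi> ! m) | Zvar \<Rightarrow> False
    | Avar k \<Rightarrow> k \<noteq> i | Bvar k \<Rightarrow> False)" for v
  have "\<forall>C \<in> matrix (CR n). \<not> falsifies s C"
    using i neg by (intro matrix_CR_satisfied[of n s i i]) (auto simp: s_def)
  moreover have "strategy_of R \<pi> m (restrict_assignment s (X_vars n)) = Some Zero"
    by (simp add: H const_function_def)
  moreover have "follows (s Zvar) Zero" by (simp add: follows_def s_def)
  ultimately have "\<not> falsifies s (cl (\<pi> ! m))"
    using line_sound[OF der m] by blast
  then obtain l where l: "l \<in> cl (\<pi> ! m)" "satisfies s l"
    unfolding falsifies_def by blast
  then obtain k j where "var l = Xvar k j" using X by (auto simp: X_vars_def)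
  then show False using l taut by (cases l) (auto simp: s_def)
qed

text \<open>Dual argument: with column \<open>j\<close> false, z = 1 and only \<open>Bvar j\<close>
  false among the b-variables, the matrix holds while the clause fails.\<close>

lemma wide_clause_One:
  assumes der: "mres_derivation R (CR n) \<pi>" and m: "m < length \<pi>"
    and H: "strategy_of R \<pi> m = const_function (X_vars n) One"
    and X: "var ` cl (\<pi> ! m) \<subseteq> X_vars n"
    and taut: "\<And>x. Pos x \<in> cl (\<pi> ! m) \<Longrightarrow> Neg x \<notin> cl (\<pi> ! m)"
    and j: "j \<in> {1..n}"
  shows "\<exists>i \<in> {1..n}. Neg (Xvar i j) \<in> cl (\<pi> ! m)"
proof (rule ccontr)
  assume neg: "\<not> ?thesis"
  define s where "s v = (case v of Xvar i k \<Rightarrow> Neg v \<in> cl (\<pi> ! m) | Zvar \<Rightarrow> True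
    | Avar k \<Rightarrow> False | Bvar k \<Rightarrow> k \<noteq> j)" for v
  have "\<forall>C \<in> matrix (CR n). \<not> falsifies s C"
    using j neg by (intro matrix_CR_satisfied[of n s j j]) (auto simp: s_def)
  moreover have "strategy_of R \<pi> m (restrict_assignment s (X_vars n)) = Some One"
    by (simp add: H const_function_def)
  moreover have "follows (s Zvar) One" by (simp add: follows_def s_def)
  ultimately have "\<not> falsifies s (cl (\<pi> ! m))"
    using line_sound[OF der m] by blast
  then obtain l where l: "l \<in> cl (\<pi> ! m)" "satisfies s l"
    unfolding falsifies_def by blast
  then obtain i k where "var l = Xvar i k" using X by (auto simp: X_vars_def)
  then show False using l taut by (cases l) (auto simp: s_def)
qed

section \<open>Pivots in \<open>A \<union> B\<close>\<close>

text \<open>To treat both kinds of pivots at once, \<open>Y\<close> stands for \<open>Avar\<close> or \<open>Bvar\<close>, \<open>L\<close> for the sign of the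
  \<open>x\<close>-variables in the axioms containing \<open>Y k\<close>, and \<open>r i j\<close> for the index \<open>k\<close> of the variable \<open>Y k\<close>
  that accompanies \<open>L x\<^sub>i\<^sub>j\<close>.\<close>

lemma regular_pivot_constant_strategy:
  fixes Y :: "nat \<Rightarrow> cr_var" and L :: "cr_var \<Rightarrow> cr_var lit" and r :: "nat \<Rightarrow> nat \<Rightarrow> nat"
  assumes der: "mres_derivation R (CR n) \<pi>" and n: "2 \<le> n"
    and reg: "regular_wrt (A_vars n \<union> B_vars n) \<pi>"
    and root: "ancestor \<pi> m (length \<pi> - 1)" and m: "m < length \<pi>"
    and rule: "rule (\<pi> ! m) = Resolve a b (Y k)"
    and X: "var ` cl (\<pi> ! m) \<subseteq> X_vars n"
    and varL: "\<And>v. var (L v) = v" and "inj Y"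
    and Y: "range Y \<inter> X_vars n = {}" "Y k \<in> A_vars n \<union> B_vars n"
    and short: "\<And>C l i j. axiom_line R (CR n) C l \<Longrightarrow> L (Xvar i j) \<in> cl l \<Longrightarrow> Pos (Y (r i j)) \<in> cl l"
    and long: "\<And>C l i. axiom_line R (CR n) C l \<Longrightarrow> Neg (Y i) \<in> cl l \<Longrightarrow> Neg (Y k) \<in> cl l"
  shows "\<exists>p \<in> {Zero, One}. strategy_of R \<pi> m = const_function (X_vars n) p"
proof -
  note d = derivation_Resolve[OF der m rule]
  have len: "a < length \<pi>" "b < length \<pi>" using d m by auto
  have "\<pi> \<noteq> []" using m by auto
  have "has_pivot (\<pi> ! m) (Y k)" using rule by (auto simp: has_pivot_def)
  then have nopiv: "Y k \<notin> pivots \<pi> a" "Y k \<notin> pivots \<pi> b"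
    using regular_pivot_unique[OF der reg Y(2) \<open>\<pi> \<noteq> []\<close> root] d(4,5) by blast+
  have "Y k \<notin> X_vars n" using Y(1) by blast
  then have res: "is_resolvent (cl (\<pi> ! a)) (cl (\<pi> ! b)) (Y k) (cl (\<pi> ! m))"
    and cons: "consistent (strategy_of R \<pi> a) (strategy_of R \<pi> b)"
    and comp: "strategy_of R \<pi> m = compose (strategy_of R \<pi> a) (strategy_of R \<pi> b)"
    using d(3) by (auto elim!: resolution_line_CR_cases)
  \<comment> \<open>The resolvent is over the x-variables, so the pivot literal is the only other
    literal in each premise.\<close>
  have a_lits: "Pos (Y k) \<in> cl (\<pi> ! a)" "Neg (Y k) \<notin> cl (\<pi> ! a)"
    and b_lits: "Neg (Y k) \<in> cl (\<pi> ! b)" "Pos (Y k) \<notin> cl (\<pi> ! b)"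
    and a_vars: "\<And>l. l \<in> cl (\<pi> ! a) \<Longrightarrow> l = Pos (Y k) \<or> var l \<in> X_vars n"
    and b_vars: "\<And>l. l \<in> cl (\<pi> ! b) \<Longrightarrow> l = Neg (Y k) \<or> var l \<in> X_vars n"
    using res X \<open>Y k \<notin> X_vars n\<close> unfolding is_resolvent_def image_subset_iff
    by (metis DiffI UnCI singletonD var.simps lit.distinct(1))+
  have origin: "\<exists>t. ancestor \<pi> t c \<and> Pos (Y (r i j)) \<in> cl (\<pi> ! t)"
    if piv: "Xvar i j \<in> pivots \<pi> c" and c: "c < length \<pi>" for c i j
  proof -
    obtain t C where t: "ancestor \<pi> t c" "rule (\<pi> ! t) = Axiom C" "L (Xvar i j) \<in> cl (\<pi> ! t)"
      using pivot_origin[OF der c, of "L (Xvar i j)"] varL piv by metis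
    then have "axiom_line R (CR n) C (\<pi> ! t)"
      using derivation_Axiom[OF der] ancestor_less_length c by blast
    then show ?thesis using t short by blast
  qed
  \<comment> \<open>Such a pivot needs the long clause containing \<open>Neg (Y i)\<close>, hence
    also \<open>Neg (Y k)\<close>, which would persist into the clause of \<open>a\<close>.\<close>
  have no_Y: "Y i \<notin> pivots \<pi> a" for i
  proof
    assume "Y i \<in> pivots \<pi> a"
    then obtain t C where t: "ancestor \<pi> t a" "rule (\<pi> ! t) = Axiom C" "Neg (Y i) \<in> cl (\<pi> ! t)"
      using pivot_origin[OF der len(1), of "Neg (Y i)"] by auto
    then have "axiom_line R (CR n) C (\<pi> ! t)"
      using derivation_Axiom[OF der] ancestor_less_length len(1) by blast
    then have "Neg (Y k) \<in> cl (\<pi> ! t)" using t long by blast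
    then have "Neg (Y k) \<in> cl (\<pi> ! a)"
      using literal_persists[OF der t(1)] nopiv by simp
    then show False using a_lits by blast
  qed
  have a_pivots: "r i j = k" if piv: "Xvar i j \<in> pivots \<pi> a" for i j
  proof -
    obtain t where "ancestor \<pi> t a" "Pos (Y (r i j)) \<in> cl (\<pi> ! t)"
      using origin[OF piv len(1)] by blast
    then have "Pos (Y (r i j)) \<in> cl (\<pi> ! a)"
      using literal_persists[OF der] no_Y by simp
    then show ?thesis using a_vars Y(1) \<open>inj Y\<close> by (fastforce dest: injD)
  qed
  \<comment> \<open>The literal \<open>Pos (Y k)\<close> of the short axiom would persist into the
    clause of \<open>b\<close>.\<close>
  have b_pivots: "r i j \<noteq> k" if piv: "Xvar i j \<in> pivots \<pi> b" for i j
  proof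
    assume "r i j = k"
    then obtain t where "ancestor \<pi> t b" "Pos (Y k) \<in> cl (\<pi> ! t)"
      using origin[OF piv len(2)] by blast
    then have "Pos (Y k) \<in> cl (\<pi> ! b)"
      using literal_persists[OF der] nopiv by simp
    then show False using b_lits by blast
  qed
  have a_Star: "strategy_of R \<pi> a \<alpha> \<noteq> Some Star" for \<alpha>
    using Star_only_long_clauses[OF der len(1), of \<alpha>] a_lits by (auto simp: LA_clause_def LB_clause_def)
  \<comment> \<open>For \<open>n\<close> at least 2 a long clause has two literals over A \<union>
    B, but \<open>b\<close> has only one.\<close>
  have b_Star: "strategy_of R \<pi> b \<alpha> \<noteq> Some Star" for \<alpha>
  proof
    assume "strategy_of R \<pi> b \<alpha> = Some Star"
    then have "cl (\<pi> ! b) = LA_clause n \<or> cl (\<pi> ! b) = LB_clause n"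
      by (rule Star_only_long_clauses[OF der len(2)])
    moreover have "{Neg (Avar 1), Neg (Avar 2)} \<subseteq> LA_clause n" "{Neg (Bvar 1), Neg (Bvar 2)} \<subseteq> LB_clause n"
      using n by (auto simp: LA_clause_def LB_clause_def)
    moreover have "Avar i \<notin> X_vars n" "Bvar i \<notin> X_vars n" for i
      by (auto simp: X_vars_def)
    ultimately have "{Neg (Avar 1), Neg (Avar 2)} \<subseteq> {Neg (Y k)} \<or> {Neg (Bvar 1), Neg (Bvar 2)} \<subseteq> {Neg (Y k)}"
      using b_vars by (metis insert_subset singletonI subset_refl empty_subsetI var.simps(2))
    then show False by (cases "Y k") auto
  qed
  have eq: "strategy_of R \<pi> a \<alpha> = strategy_of R \<pi> b \<alpha>" if \<alpha>: "dom \<alpha> = X_vars n" for \<alpha>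
  proof -
    obtain p where p: "strategy_of R \<pi> a \<alpha> = Some p"
      by (rule strategy_of_total[OF der len(1) \<alpha>])
    obtain q where q: "strategy_of R \<pi> b \<alpha> = Some q"
      by (rule strategy_of_total[OF der len(2) \<alpha>])
    from p q have "consistent_val p q" using cons unfolding consistent_def by blast
    then show ?thesis using p q a_Star[of \<alpha>] b_Star[of \<alpha>] by (auto simp: consistent_val_def)
  qed
  have const: "strategy_of R \<pi> a \<alpha> = strategy_of R \<pi> a \<beta>"
    if \<alpha>\<beta>: "dom \<alpha> = X_vars n" "dom \<beta> = X_vars n" for \<alpha> \<beta>
  proof -
    \<comment> \<open>A hybrid agreeing with \<alpha> on the x-variables queried by \<open>a\<close>
      and with \<beta> on those queried by \<open>b\<close>. The strategies of \<open>a\<close> and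
      \<open>b\<close> coincide at \<gamma>, which links the value at \<alpha> to the value at
      \<beta>.\<close>
    define \<gamma> where "\<gamma> = (\<lambda>x. if \<exists>i j. x = Xvar i j \<and> r i j = k then \<alpha> x else \<beta> x)"
    have \<gamma>: "dom \<gamma> = X_vars n"
    proof -
      have "\<alpha> x \<noteq> None \<longleftrightarrow> x \<in> X_vars n" "\<beta> x \<noteq> None \<longleftrightarrow> x \<in> X_vars n" for x
        using domIff[of x \<alpha>] domIff[of x \<beta>] by (simp_all only: \<alpha>\<beta> simp_thms)
      then have "\<gamma> x \<noteq> None \<longleftrightarrow> x \<in> X_vars n" for x
        unfolding \<gamma>_def by simp
      then show ?thesis by (simp add: dom_def)
    qed
    \<comment> \<open>The pivots of \<open>a\<close> may include variables of A \<union> B, on which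
      both assignments are undefined.\<close>
    have outside: "\<alpha> x = \<beta> x" if "x \<notin> X_vars n" for x
      using that domIff[of x \<alpha>] domIff[of x \<beta>] by (simp only: \<alpha>\<beta> simp_thms)
    have "\<forall>x \<in> pivots \<pi> a. \<alpha> x = \<gamma> x"
    proof
      fix x assume "x \<in> pivots \<pi> a"
      then show "\<alpha> x = \<gamma> x"
        using outside[of x] a_pivots by (cases x) (auto simp: \<gamma>_def X_vars_def)
    qed
    moreover have "\<forall>x \<in> pivots \<pi> b. \<gamma> x = \<beta> x"
      using b_pivots unfolding \<gamma>_def by auto
    ultimately show ?thesis
      using strategy_depends_on_pivots[OF der len(1) \<alpha>\<beta>(1) \<gamma>]
        strategy_depends_on_pivots[OF der len(2) \<gamma> \<alpha>\<beta>(2)] eq[OF \<gamma>] eq[OF \<alpha>\<beta>(2)] by simp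
  qed
  define \<alpha>\<^sub>0 where "\<alpha>\<^sub>0 = restrict_assignment (\<lambda>_. True) (X_vars n)"
  have \<alpha>\<^sub>0: "dom \<alpha>\<^sub>0 = X_vars n" by (simp add: \<alpha>\<^sub>0_def)
  obtain p where p: "strategy_of R \<pi> a \<alpha>\<^sub>0 = Some p"
    by (rule strategy_of_total[OF der len(1) \<alpha>\<^sub>0])
  have "p \<in> {Zero, One}" using p a_Star[of \<alpha>\<^sub>0] by (cases p) auto
  moreover have "strategy_of R \<pi> m = const_function (X_vars n) p"
  proof
    fix \<alpha>
    show "strategy_of R \<pi> m \<alpha> = const_function (X_vars n) p \<alpha>"
    proof (cases "dom \<alpha> = X_vars n")
      case True
      then have "strategy_of R \<pi> a \<alpha> = Some p" using const[OF _ \<alpha>\<^sub>0] p by simp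
      then show ?thesis using True a_Star[of \<alpha>] by (simp add: comp compose_def const_function_def)
    next
      case False
      then have "\<alpha> \<notin> dom (strategy_of R \<pi> m)" unfolding dom_strategy_of[OF der m] by simp
      then show ?thesis using False by (simp add: const_function_def domIff)
    qed
  qed
  ultimately show ?thesis by blast
qed

text \<open>The a-variables go with positive x-literals and row indices, the b-variables with
  negative x-literals and column indices.\<close>

lemma regular_pivot_constant_strategy_CR:
  assumes der: "mres_derivation R (CR n) \<pi>" and n: "2 \<le> n"
    and reg: "regular_wrt (A_vars n \<union> B_vars n) \<pi>"
    and root: "ancestor \<pi> m (length \<pi> - 1)" and m: "m < length \<pi>"
    and rule: "rule (\<pi> ! m) = Resolve a b y" and y: "y \<in> A_vars n \<union> B_vars n"
    and X: "var ` cl (\<pi> ! m) \<subseteq> X_vars n"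
  shows "\<exists>p \<in> {Zero, One}. strategy_of R \<pi> m = const_function (X_vars n) p"
proof -
  note base = regular_pivot_constant_strategy[OF der n reg root m _ X]
  from y consider k where "y = Avar k" "k \<in> {1..n}" | k where "y = Bvar k" "k \<in> {1..n}"
    by (auto simp: A_vars_def B_vars_def)
  then show ?thesis
  proof cases
    case (1 k)
    show ?thesis
    proof (rule base[where L = Pos and Y = Avar and k = k and r = "\<lambda>i j. i"])
      show "Pos (Avar i) \<in> cl l" if "axiom_line R (CR n) C l" "Pos (Xvar i j) \<in> cl l" for C l i j
        using that by (cases rule: axiom_clause_CR_cases) (auto simp: LA_clause_def LB_clause_def)
      show "Neg (Avar k) \<in> cl l" if "axiom_line R (CR n) C l" "Neg (Avar i) \<in> cl l" for C l i
        using that 1 by (cases rule: axiom_clause_CR_cases) (auto simp: LA_clause_def LB_clause_def)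
    qed (use rule y 1 in \<open>auto simp: inj_def X_vars_def\<close>)
  next
    case (2 k)
    show ?thesis
    proof (rule base[where L = Neg and Y = Bvar and k = k and r = "\<lambda>i j. j"])
      show "Pos (Bvar j) \<in> cl l" if "axiom_line R (CR n) C l" "Neg (Xvar i j) \<in> cl l" for C l i j
        using that by (cases rule: axiom_clause_CR_cases) (auto simp: LA_clause_def LB_clause_def)
      show "Neg (Bvar k) \<in> cl l" if "axiom_line R (CR n) C l" "Neg (Bvar i) \<in> cl l" for C l i
        using that 2 by (cases rule: axiom_clause_CR_cases) (auto simp: LA_clause_def LB_clause_def)
    qed (use rule y 2 in \<open>auto simp: inj_def X_vars_def\<close>)
  qed
qed

text \<open>An x-pivot always has a premise falsified by \<open>s\<close>, and this premise is again
  over the x-variables. The descent cannot end in an axiom, since every axiom contains a variable of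
  A \<union> B.\<close>

lemma falsified_pivot_line:
  assumes der: "mres_derivation R (CR n) \<pi>" and n: "1 \<le> n" and "m < length \<pi>"
    and "ancestor \<pi> m (length \<pi> - 1)" "var ` cl (\<pi> ! m) \<subseteq> X_vars n" "falsifies s (cl (\<pi> ! m))"
  shows "\<exists>m' a b y. m' < length \<pi> \<and> ancestor \<pi> m' (length \<pi> - 1) \<and> var ` cl (\<pi> ! m') \<subseteq> X_vars n \<and>
    falsifies s (cl (\<pi> ! m')) \<and> rule (\<pi> ! m') = Resolve a b y \<and> y \<in> A_vars n \<union> B_vars n"
  using der assms(3-6)
proof (induction rule: derivation_induct)
  case (Axiom m C)
  \<comment> \<open>\<open>n\<close> positive makes the long clauses nonempty.\<close>
  have "Neg (Avar 1) \<in> LA_clause n" "Neg (Bvar 1) \<in> LB_clause n"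
    using n by (auto simp: LA_clause_def LB_clause_def)
  with Axiom.hyps(3) have "\<exists>l \<in> cl (\<pi> ! m). \<exists>i. var l = Avar i \<or> var l = Bvar i"
    by (elim axiom_clause_CR_cases) force+
  then show ?case using Axiom.prems(2) by (auto simp: X_vars_def)
next
  case (Resolve m a b x)
  from Resolve.hyps(7) show ?case
  proof (cases rule: resolution_line_CR_cases)
    case 1
    have anc: "ancestor \<pi> a (length \<pi> - 1)" "ancestor \<pi> b (length \<pi> - 1)"
      by (rule converse_rtranclp_into_rtranclp, fact Resolve.hyps, fact Resolve.prems)+
    have vars: "var ` cl (\<pi> ! a) \<subseteq> X_vars n" "var ` cl (\<pi> ! b) \<subseteq> X_vars n"
      using 1(1,2) Resolve.prems unfolding is_resolvent_def image_subset_iff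
      by (metis DiffI UnCI singletonD var.simps)+
    show ?thesis
    proof (cases "s x")
      case True
      then have "falsifies s (cl (\<pi> ! b))"
        using 1 Resolve.prems unfolding is_resolvent_def falsifies_def by auto
      then show ?thesis using Resolve.IH(2) anc vars by blast
    next
      case False
      then have "falsifies s (cl (\<pi> ! a))"
        using 1 Resolve.prems unfolding is_resolvent_def falsifies_def by auto
      then show ?thesis using Resolve.IH(1) anc vars by blast
    qed
  next
    case 2
    then show ?thesis using Resolve.hyps(1,2) Resolve.prems by blast
  qed
qed

section \<open>Counting\<close>

lemma finite_X_vars: "finite (X_vars n)"
  unfolding X_vars_def by (rule finite_pair_image)

text \<open>An assignment, given by its set of true variables, is determined by its part outside
  \<open>T\<close> once its trace on \<open>T\<close> is fixed. The product form avoids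
  division.\<close>

lemma card_Pow_fixed_le:
  assumes "finite V" "T \<subseteq> V" "\<And>\<alpha>. \<alpha> \<in> F \<Longrightarrow> \<alpha> \<subseteq> V \<and> \<alpha> \<inter> T = Z"
  shows "card F * 2 ^ card T \<le> 2 ^ card V"
proof -
  have "inj_on (\<lambda>\<alpha>. \<alpha> - T) F"
    using assms(3) by (intro inj_onI) blast
  then have "card F \<le> card (Pow (V - T))"
    using assms by (intro card_inj_on_le[of "\<lambda>\<alpha>. \<alpha> - T"]) auto
  also have "\<dots> = 2 ^ (card V - card T)"
    using assms by (simp add: card_Pow card_Diff_subset finite_subset)
  finally have "card F * 2 ^ card T \<le> 2 ^ (card V - card T) * 2 ^ card T" by simp
  also have "\<dots> = 2 ^ card V"
    using assms by (simp flip: power_add add: card_mono)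
  finally show ?thesis .
qed

lemma card_falsified_le:
  assumes der: "mres_derivation R (CR n) \<pi>" and n: "2 \<le> n"
    and reg: "regular_wrt (A_vars n \<union> B_vars n) \<pi>"
    and m: "ancestor \<pi> m (length \<pi> - 1)" "m < length \<pi>"
      "rule (\<pi> ! m) = Resolve a b y" "y \<in> A_vars n \<union> B_vars n"
      "var ` cl (\<pi> ! m) \<subseteq> X_vars n"
  shows "card {\<alpha> \<in> Pow (X_vars n). falsifies (\<lambda>x. x \<in> \<alpha>) (cl (\<pi> ! m))} * 2 ^ n \<le> 2 ^ card (X_vars n)"
    (is "card ?F * _ \<le> _")
proof (cases "?F = {}")
  case True
  then show ?thesis by (simp only: card.empty mult_0 zero_le)
next
  case False
  then obtain \<alpha> where "falsifies (\<lambda>x. x \<in> \<alpha>) (cl (\<pi> ! m))" by blast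
  \<comment> \<open>A falsifiable clause is not a tautology, as the width lemmas require; this is
    why an empty \<open>?F\<close> is treated first.\<close>
  then have taut: "Neg x \<notin> cl (\<pi> ! m)" if "Pos x \<in> cl (\<pi> ! m)" for x
    using that unfolding falsifies_def by (metis satisfies.simps)
  have "\<exists>T Z. T \<subseteq> X_vars n \<and> card T = n \<and> (\<forall>\<alpha> \<in> ?F. \<alpha> \<inter> T = Z)"
  proof (cases "strategy_of R \<pi> m = const_function (X_vars n) Zero")
    case True
    obtain f where f: "f i \<in> {1..n}" "Pos (Xvar i (f i)) \<in> cl (\<pi> ! m)" if "i \<in> {1..n}" for i
      using wide_clause_Zero[OF der m(2) True m(5) taut] by metis
    \<comment> \<open>One literal per row gives \<open>n\<close> distinct variables, all forced to
      be false.\<close>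
    let ?T = "(\<lambda>i. Xvar i (f i)) ` {1..n}"
    have "card ?T = n" by (simp add: card_image inj_on_def)
    moreover have "?T \<subseteq> X_vars n" using f unfolding X_vars_def by blast
    moreover have "Xvar i (f i) \<notin> \<alpha>" if "i \<in> {1..n}" "\<alpha> \<in> ?F" for i \<alpha>
      using f(2)[OF that(1)] that(2) unfolding falsifies_def by force
    then have "\<forall>\<alpha> \<in> ?F. \<alpha> \<inter> ?T = {}" by blast
    ultimately show ?thesis by blast
  next
    case False
    then have One: "strategy_of R \<pi> m = const_function (X_vars n) One"
      using regular_pivot_constant_strategy_CR[OF der n reg m] by blast
    obtain f where f: "f j \<in> {1..n}" "Neg (Xvar (f j) j) \<in> cl (\<pi> ! m)" if "j \<in> {1..n}" for j
      using wide_clause_One[OF der m(2) One m(5) taut] by metis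
    \<comment> \<open>One literal per column gives \<open>n\<close> distinct variables, all forced
      to be true.\<close>
    let ?T = "(\<lambda>j. Xvar (f j) j) ` {1..n}"
    have "card ?T = n" by (simp add: card_image inj_on_def)
    moreover have "?T \<subseteq> X_vars n" using f unfolding X_vars_def by blast
    moreover have "Xvar (f j) j \<in> \<alpha>" if "j \<in> {1..n}" "\<alpha> \<in> ?F" for j \<alpha>
      using f(2)[OF that(1)] that(2) unfolding falsifies_def by force
    then have "\<forall>\<alpha> \<in> ?F. \<alpha> \<inter> ?T = ?T" by blast
    ultimately show ?thesis by blast
  qed
  then obtain T Z where T: "T \<subseteq> X_vars n" "card T = n" "\<forall>\<alpha> \<in> ?F. \<alpha> \<inter> T = Z"
    by (elim exE conjE)
  have "card ?F * 2 ^ card T \<le> 2 ^ card (X_vars n)"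
    by (rule card_Pow_fixed_le[OF finite_X_vars T(1), of _ Z]) (use T(3) in simp)
  then show ?thesis by (simp only: T(2))
qed

text \<open>Every assignment falsifies the empty clause and so, by the descent, the clause of some
  line in \<open>M\<close>. Each such line accounts for at most a fraction 1/2^n of the assignments,
  so \<open>M\<close> has at least 2^n lines.\<close>

lemma regular_refutation_size:
  assumes ref: "mres_refutation R (CR n) \<pi>" and n: "2 \<le> n"
    and reg: "regular_wrt (A_vars n \<union> B_vars n) \<pi>"
  shows "2 ^ n \<le> length \<pi>"
proof -
  have der: "mres_derivation R (CR n) \<pi>" and "\<pi> \<noteq> []" and empty: "cl (\<pi> ! (length \<pi> - 1)) = {}"
    using ref by (auto simp: mres_refutation_def last_conv_nth)
  define M where "M = {m. m < length \<pi> \<and> ancestor \<pi> m (length \<pi> - 1) \<and>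
    var ` cl (\<pi> ! m) \<subseteq> X_vars n \<and> (\<exists>a b y. rule (\<pi> ! m) = Resolve a b y \<and> y \<in> A_vars n \<union> B_vars n)}"
  define F where "F m = {\<alpha> \<in> Pow (X_vars n). falsifies (\<lambda>x. x \<in> \<alpha>) (cl (\<pi> ! m))}" for m
  have M: "M \<subseteq> {..<length \<pi>}" "finite M" unfolding M_def by auto
  have "\<exists>m \<in> M. \<alpha> \<in> F m" if "\<alpha> \<in> Pow (X_vars n)" for \<alpha>
  proof -
    have "length \<pi> - 1 < length \<pi>" "var ` cl (\<pi> ! (length \<pi> - 1)) \<subseteq> X_vars n"
      "falsifies (\<lambda>x. x \<in> \<alpha>) (cl (\<pi> ! (length \<pi> - 1)))"
      using \<open>\<pi> \<noteq> []\<close> by (simp_all only: empty falsifies_def) auto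
    note falsified_pivot_line[OF der _ this(1) rtranclp.rtrancl_refl this(2,3)]
    then have "\<exists>m \<in> M. falsifies (\<lambda>x. x \<in> \<alpha>) (cl (\<pi> ! m))"
      using n unfolding M_def by simp blast
    then show ?thesis using that unfolding F_def by blast
  qed
  then have "Pow (X_vars n) \<subseteq> (\<Union>m \<in> M. F m)" by blast
  moreover have "finite (\<Union>m \<in> M. F m)"
    using M finite_X_vars unfolding F_def by auto
  ultimately have "card (Pow (X_vars n)) \<le> card (\<Union>m \<in> M. F m)" by (intro card_mono)
  also have "\<dots> \<le> (\<Sum>m \<in> M. card (F m))" by (rule card_UN_le[OF M(2)])
  finally have "2 ^ card (X_vars n) * 2 ^ n \<le> (\<Sum>m \<in> M. card (F m)) * 2 ^ n"
    using finite_X_vars by (simp add: card_Pow)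
  also have "\<dots> = (\<Sum>m \<in> M. card (F m) * 2 ^ n)" by (rule sum_distrib_right)
  also have "\<dots> \<le> (\<Sum>m \<in> M. 2 ^ card (X_vars n))"
    using card_falsified_le[OF der n reg] unfolding M_def F_def by (intro sum_mono) blast
  also have "\<dots> \<le> length \<pi> * 2 ^ card (X_vars n)"
    using card_mono[OF _ M(1)] by simp
  finally show ?thesis by simp
qed

theorem theorem12:
  fixes R :: "('r, cr_var) representation"
  assumes "complete_representation R"
  shows "\<exists>c::real. c > 0 \<and> (\<exists>N::nat. \<forall>n\<ge>N. \<forall>\<pi> :: ('r, cr_var) line list.
           mres_refutation R (CR n) \<pi> \<longrightarrow>
           regular_wrt (A_vars n \<union> B_vars n) \<pi> \<longrightarrow>
           real (proof_size \<pi>) \<ge> 2 powr (c * real n))"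
proof -
  have "2 powr (1 * real n) \<le> real (proof_size \<pi>)"
    if "2 \<le> n" "mres_refutation R (CR n) \<pi>" "regular_wrt (A_vars n \<union> B_vars n) \<pi>"
    for n and \<pi> :: "('r, cr_var) line list"
  proof -
    have "2 ^ n \<le> length \<pi>" using regular_refutation_size that by blast
    then have "(2::real) ^ n \<le> real (length \<pi>)" by (metis of_nat_le_iff of_nat_numeral of_nat_power)
    then show ?thesis by (simp add: proof_size_def powr_realpow)
  qed
  \<comment> \<open>The bound is 2^n itself, so c = 1; N = 2 is the least \<open>n\<close> for which
    the long clauses have two literals.\<close>
  then show ?thesis by (intro exI[of _ "1::real"] exI[of _ "2::nat"] conjI allI impI zero_less_one)
qed

end
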